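(* Let $T$ be a rooted homogeneous tree of order $\gamma$. If $B$ is the backward shift on $\mathcal{L}_0$, then $$\sigma(B)=\sigma_{\mathrm{ap}}(B)=\{\lambda\in\mathbb{C}:|\lambda|\le\gamma\}.$$
   Context: A tree is an undirected graph (no loops or multiple edges) in which any two vertices are joined by exactly one path; $T$ also denotes its vertex set, which is assumed countably infinite, and every vertex has finite degree. $T$ has a distinguished vertex $o$, the root; $|v|$ is the length (number of edges) of the path from $o$ to $v$. For $v\neq o$, the parent $\mathrm{par}(v)$ is the vertex preceding $v$ on the unique path from $o$ to $v$; $\mathrm{Chi}(v)$ is the set of children of $v$ (vertices with parent $v$), and $\gamma(v)$ is its cardinality. $T$ is homogeneous of order $\gamma$ if $\gamma(v)=\gamma$ for all $v\in T$ (so $\gamma\geq 1$). For $f:T\to\mathbb{C}$ define $f'(o)=f(o)$ and $f'(v)=f(v)-f(\mathrm{par}(v))$ for $v\neq o$. The little Lipschitz space $\mathcal{L}_0$ is the Banach space of all $f:T\to\mathbb{C}$ with $\lim_{|v|\to\infty}f'(v)=0$, with norm $\|f\|=\sup_{v\in T}|f'(v)|$. The backward shift is $(Bf)(v)=\sum_{w\in\mathrm{Chi}(v)}f(w)$; it is bounded on $\mathcal{L}_0$ for homogeneous $T$. $\sigma$ and $\sigma_{\mathrm{ap}}$ denote the spectrum and the approximate point spectrum. *)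

theory Defs
  imports Complex_Main "HOL-Library.Countable_Set"
begin

text \<open>
  A simple graph is given by its adjacency relation \<open>E\<close>; its vertex set is the whole type \<open>'v\<close>,
  so that functions from the vertices to the complex numbers are exactly the elements of
  \<open>'v \<Rightarrow> complex\<close>.
\<close>

definition tree_path :: "('v \<Rightarrow> 'v \<Rightarrow> bool) \<Rightarrow> 'v \<Rightarrow> 'v list \<Rightarrow> 'v \<Rightarrow> bool" where
  "tree_path E u p v \<longleftrightarrow>
     p \<noteq> [] \<and> hd p = u \<and> last p = v \<and> distinct p \<and> successively E p"

definition is_tree :: "('v \<Rightarrow> 'v \<Rightarrow> bool) \<Rightarrow> bool" where
  "is_tree E \<longleftrightarrow> irreflp E \<and> symp E \<and> (\<forall>u v. \<exists>!p. tree_path E u p v)"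

definition locally_finite_graph :: "('v \<Rightarrow> 'v \<Rightarrow> bool) \<Rightarrow> bool" where
  "locally_finite_graph E \<longleftrightarrow> (\<forall>v. finite {w. E v w})"

definition the_path :: "('v \<Rightarrow> 'v \<Rightarrow> bool) \<Rightarrow> 'v \<Rightarrow> 'v \<Rightarrow> 'v list" where
  "the_path E u v = (THE p. tree_path E u p v)"

text \<open>Below, \<open>r\<close> is the root. Paths are lists of vertices, hence the subtraction of 1.\<close>

definition tree_level :: "('v \<Rightarrow> 'v \<Rightarrow> bool) \<Rightarrow> 'v \<Rightarrow> 'v \<Rightarrow> nat" where
  "tree_level E r v = length (the_path E r v) - 1"

text \<open>Only meaningful for \<open>v \<noteq> r\<close>.\<close>

definition tree_parent :: "('v \<Rightarrow> 'v \<Rightarrow> bool) \<Rightarrow> 'v \<Rightarrow> 'v \<Rightarrow> 'v" where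
  "tree_parent E r v = last (butlast (the_path E r v))"

definition tree_children :: "('v \<Rightarrow> 'v \<Rightarrow> bool) \<Rightarrow> 'v \<Rightarrow> 'v \<Rightarrow> 'v set" where
  "tree_children E r v = {w. w \<noteq> r \<and> tree_parent E r w = v}"

definition homogeneous_tree :: "('v \<Rightarrow> 'v \<Rightarrow> bool) \<Rightarrow> 'v \<Rightarrow> nat \<Rightarrow> bool" where
  "homogeneous_tree E r \<gamma> \<longleftrightarrow> (\<forall>v. card (tree_children E r v) = \<gamma>)"

definition tree_deriv ::
  "('v \<Rightarrow> 'v \<Rightarrow> bool) \<Rightarrow> 'v \<Rightarrow> ('v \<Rightarrow> complex) \<Rightarrow> 'v \<Rightarrow> complex" where
  "tree_deriv E r f v = (if v = r then f r else f v - f (tree_parent E r v))"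

text \<open>The filter \<open>filtercomap (tree_level E r) at_top\<close> expresses that the level of \<open>v\<close> tends to
  infinity.\<close>

definition little_lipschitz :: "('v \<Rightarrow> 'v \<Rightarrow> bool) \<Rightarrow> 'v \<Rightarrow> ('v \<Rightarrow> complex) set" where
  "little_lipschitz E r =
     {f. (tree_deriv E r f \<longlongrightarrow> 0) (filtercomap (tree_level E r) at_top)}"

text \<open>For \<open>f\<close> in the little Lipschitz space of a locally finite tree the supremum is over a bounded
  set, because every level is finite.\<close>

definition lipschitz_norm :: "('v \<Rightarrow> 'v \<Rightarrow> bool) \<Rightarrow> 'v \<Rightarrow> ('v \<Rightarrow> complex) \<Rightarrow> real" where
  "lipschitz_norm E r f = (SUP v. cmod (tree_deriv E r f v))"

definition backward_shift ::
  "('v \<Rightarrow> 'v \<Rightarrow> bool) \<Rightarrow> 'v \<Rightarrow> ('v \<Rightarrow> complex) \<Rightarrow> 'v \<Rightarrow> complex" where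
  "backward_shift E r f v = (\<Sum>w\<in>tree_children E r v. f w)"

text \<open>
  Operators on a complex normed space of functions, given by its carrier \<open>X\<close> (a linear subspace
  of \<open>'v \<Rightarrow> complex\<close>) and its norm \<open>N\<close>. The spectra below are meant for bounded
  operators \<open>A\<close>; the values of an operator outside \<open>X\<close> are irrelevant.
\<close>

definition bounded_operator_on ::
  "('v \<Rightarrow> complex) set \<Rightarrow> (('v \<Rightarrow> complex) \<Rightarrow> real) \<Rightarrow>
   (('v \<Rightarrow> complex) \<Rightarrow> ('v \<Rightarrow> complex)) \<Rightarrow> bool" where
  "bounded_operator_on X N A \<longleftrightarrow>
     (\<forall>f\<in>X. A f \<in> X) \<and>
     (\<forall>f\<in>X. \<forall>g\<in>X. A (\<lambda>v. f v + g v) = (\<lambda>v. A f v + A g v)) \<and>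
     (\<forall>c. \<forall>f\<in>X. A (\<lambda>v. c * f v) = (\<lambda>v. c * A f v)) \<and>
     (\<exists>C. \<forall>f\<in>X. N (A f) \<le> C * N f)"

definition shifted_op ::
  "(('v \<Rightarrow> complex) \<Rightarrow> ('v \<Rightarrow> complex)) \<Rightarrow> complex \<Rightarrow> ('v \<Rightarrow> complex) \<Rightarrow> 'v \<Rightarrow> complex" where
  "shifted_op A z f = (\<lambda>v. A f v - z * f v)"

definition boundedly_invertible_on ::
  "('v \<Rightarrow> complex) set \<Rightarrow> (('v \<Rightarrow> complex) \<Rightarrow> real) \<Rightarrow>
   (('v \<Rightarrow> complex) \<Rightarrow> ('v \<Rightarrow> complex)) \<Rightarrow> bool" where
  "boundedly_invertible_on X N A \<longleftrightarrow>
     bounded_operator_on X N A \<and>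
     (\<exists>S. bounded_operator_on X N S \<and> (\<forall>f\<in>X. S (A f) = f) \<and> (\<forall>f\<in>X. A (S f) = f))"

definition op_spectrum ::
  "('v \<Rightarrow> complex) set \<Rightarrow> (('v \<Rightarrow> complex) \<Rightarrow> real) \<Rightarrow>
   (('v \<Rightarrow> complex) \<Rightarrow> ('v \<Rightarrow> complex)) \<Rightarrow> complex set" where
  "op_spectrum X N A = {z. \<not> boundedly_invertible_on X N (shifted_op A z)}"

definition op_approx_point_spectrum ::
  "('v \<Rightarrow> complex) set \<Rightarrow> (('v \<Rightarrow> complex) \<Rightarrow> real) \<Rightarrow>
   (('v \<Rightarrow> complex) \<Rightarrow> ('v \<Rightarrow> complex)) \<Rightarrow> complex set" where
  "op_approx_point_spectrum X N A =
     {z. \<exists>F :: nat \<Rightarrow> 'v \<Rightarrow> complex.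
        (\<forall>n. F n \<in> X \<and> N (F n) = 1) \<and> (\<lambda>n. N (shifted_op A z (F n))) \<longlonglongrightarrow> 0}"

end

theory Submission
  imports Defs "HOL-Analysis.Uniform_Limit"
begin

text \<open>
  The closed disc lies in the approximate point spectrum, which lies in the spectrum, which lies
  in the closed disc. The middle inclusion holds for any operator.
  
  \<^bold>\<open>The disc consists of approximate eigenvalues.\<close> A radial function \<open>q ^ |v|\<close> satisfies
  \<open>B f = \<gamma> q f\<close>, because each vertex has \<open>\<gamma>\<close> children, all at the next level. For \<open>|q| < 1\<close> its
  derivative tends to \<open>0\<close>, so every \<open>z\<close> with \<open>|z| < \<gamma>\<close> is an eigenvalue
  (\<open>unit_eigenvector\<close>). A point \<open>z\<close> of the closed disc is the limit of points \<open>t\<^sub>n\<close> of the open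
  disc, and normalised eigenvectors for \<open>t\<^sub>n\<close> satisfy \<open>N ((B - z) F\<^sub>n) = |t\<^sub>n - z|\<close>.
  
  \<^bold>\<open>Outside the disc there is a resolvent.\<close> The norm of \<open>B\<close> may exceed \<open>\<gamma>\<close>, so
  the convergence of the Neumann series rests on the growth of the powers of \<open>B\<close>. The value
  \<open>(B ^^ n) f v\<close> adds up \<open>f\<close> over the \<open>\<gamma> ^ n\<close> descendants of \<open>v\<close> that lie \<open>n\<close> levels further
  down, and each of these values differs from \<open>f v\<close> by at most \<open>n\<close> times the norm of \<open>f\<close>
  (\<open>shift_pow_approx\<close>). Hence \<open>B ^^ n\<close> has norm at most \<open>(2 n + 1) \<gamma> ^ n\<close>
  (\<open>deriv_shift_pow_le\<close>), and the Neumann series converges for \<open>|z| > \<gamma>\<close>. The space is a set of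
  functions and not a Banach space type, so the series is summed pointwise: dominated
  convergence keeps its sum in the space (\<open>resolvent_mem\<close>), and telescoping shows that it inverts
  \<open>B - z\<close> (\<open>resolvent_left_inverse\<close>).
\<close>

section \<open>Approximate eigenvalues and bounded inverses\<close>

text \<open>
  A bounded inverse \<open>S\<close> would give \<open>1 = N (S (A (F n))) \<le> C * N (A (F n))\<close> for all \<open>n\<close>.
\<close>

lemma not_boundedly_invertible_if_approximate_null_sequence:
  assumes F: "\<And>n. F n \<in> X" "\<And>n. N (F n) = 1"
    and lim: "(\<lambda>n. N (A (F n))) \<longlonglongrightarrow> 0"
  shows "\<not> boundedly_invertible_on X N A"
proof
  assume "boundedly_invertible_on X N A"
  then obtain S C where inv: "\<And>f. f \<in> X \<Longrightarrow> S (A f) = f"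
    and C: "\<And>f. f \<in> X \<Longrightarrow> N (S f) \<le> C * N f" and A: "\<And>f. f \<in> X \<Longrightarrow> A f \<in> X"
    unfolding boundedly_invertible_on_def bounded_operator_on_def by metis
  have "1 \<le> C * N (A (F n))" for n
    using C[OF A[OF F(1)], of n] by (simp add: inv F)
  moreover have "(\<lambda>n. C * N (A (F n))) \<longlonglongrightarrow> C * 0"
    by (intro tendsto_intros lim)
  ultimately have "(1::real) \<le> C * 0"
    by (intro LIMSEQ_le_const) auto
  thus False by simp
qed

lemma approximate_point_spectrum_subset_spectrum:
  "op_approx_point_spectrum X N A \<subseteq> op_spectrum X N A"
  unfolding op_approx_point_spectrum_def op_spectrum_def
  using not_boundedly_invertible_if_approximate_null_sequence[of _ X N] by blast

lemma summable_linear_times_geometric: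
  fixes q :: real
  assumes "\<bar>q\<bar> < 1"
  shows "summable (\<lambda>n. (2 * real n + 1) * q ^ n)"
proof -
  have "summable (\<lambda>n. real (Suc n) * q ^ n)"
    using geometric_deriv_sums[of q] assms by (auto simp: sums_iff)
  hence "summable (\<lambda>n. 2 * (real (Suc n) * q ^ n) - q ^ n)"
    using assms by (intro summable_diff summable_mult summable_geometric) auto
  thus ?thesis by (simp add: algebra_simps)
qed

locale rooted_homogeneous_tree =
  fixes E :: "'v \<Rightarrow> 'v \<Rightarrow> bool" and r :: 'v and \<gamma> :: nat
  assumes tree: "is_tree E"
    and infinite_tree: "infinite (UNIV :: 'v set)"
    and locally_finite: "locally_finite_graph E"
    and homogeneous: "homogeneous_tree E r \<gamma>"
begin

abbreviation "par \<equiv> tree_parent E r"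
abbreviation "chi \<equiv> tree_children E r"
abbreviation "lev \<equiv> tree_level E r"
abbreviation "D \<equiv> tree_deriv E r"
abbreviation "B \<equiv> backward_shift E r"
abbreviation "X \<equiv> little_lipschitz E r"
abbreviation "N \<equiv> lipschitz_norm E r"

section \<open>Levels and children in a rooted tree\<close>

lemma the_path_eqI: "tree_path E u p v \<Longrightarrow> the_path E u v = p"
  using tree unfolding is_tree_def the_path_def by (metis the_equality)

lemma tree_path_the_path: "tree_path E u (the_path E u v) v"
  using tree the_path_eqI unfolding is_tree_def by metis

lemma the_path_root: "the_path E r r = [r]"
  by (rule the_path_eqI) (simp add: tree_path_def)

text \<open>
  Cutting off the last vertex of the path from the root to \<open>v\<close> leaves a path to the parent of
  \<open>v\<close>, and by uniqueness it is the path to the parent. Levels thus increase by one from parent to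
  child, and children are neighbours, so there are only finitely many.
\<close>

lemma the_path_eq_snoc:
  assumes "v \<noteq> r"
  shows "the_path E r v = the_path E r (par v) @ [v]" and "E (par v) v"
proof -
  define p where "p = the_path E r v"
  define q where "q = butlast p"
  have p: "p \<noteq> []" "hd p = r" "last p = v" "distinct p" "successively E p"
    using tree_path_the_path[of r v] by (auto simp: tree_path_def p_def)
  have pq: "p = q @ [v]"
    using p(1,3) append_butlast_last_id[of p] by (simp add: q_def)
  have q: "q \<noteq> []"
    using p(2) pq assms by auto
  have par: "par v = last q"
    by (simp add: tree_parent_def p_def q_def)
  have "tree_path E r q (par v)"
    using p pq q par by (auto simp: tree_path_def successively_append_iff)
  hence "the_path E r (par v) = q"
    by (rule the_path_eqI)
  thus "the_path E r v = the_path E r (par v) @ [v]"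
    using pq p_def by simp
  show "E (par v) v"
    using p(5) pq q par by (auto simp: successively_append_iff)
qed

lemma level_root [simp]: "lev r = 0"
  by (simp add: tree_level_def the_path_root)

lemma level_eq_Suc:
  assumes "v \<noteq> r"
  shows "lev v = Suc (lev (par v))"
proof -
  have "the_path E r (par v) \<noteq> []"
    using tree_path_the_path[of r "par v"] by (simp add: tree_path_def)
  thus ?thesis
    using the_path_eq_snoc(1)[OF assms] by (cases "the_path E r (par v)") (auto simp: tree_level_def)
qed

lemma mem_children_iff: "w \<in> chi v \<longleftrightarrow> w \<noteq> r \<and> par w = v"
  by (simp add: tree_children_def)

lemma level_children: "w \<in> chi v \<Longrightarrow> lev w = Suc (lev v)"
  by (auto simp: mem_children_iff level_eq_Suc)

lemma finite_children: "finite (chi v)"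
proof (rule finite_subset)
  show "chi v \<subseteq> {w. E v w}"
    using the_path_eq_snoc(2) by (auto simp: mem_children_iff)
  show "finite {w. E v w}"
    using locally_finite by (simp add: locally_finite_graph_def)
qed

lemma card_children [simp]: "card (chi v) = \<gamma>"
  using homogeneous by (simp add: homogeneous_tree_def)

text \<open>
  A tree without children consists of the root alone. Finiteness enters because an infinite set of
  children would also have cardinality \<open>0\<close>.
\<close>

lemma order_pos: "\<gamma> > 0"
proof (rule ccontr)
  assume "\<not> \<gamma> > 0"
  hence "chi v = {}" for v
    using card_children[of v] finite_children[of v] by (metis card_0_eq gr0I)
  hence "(UNIV :: 'v set) \<subseteq> {r}"
    by (auto simp: tree_children_def)
  thus False
    using infinite_tree finite_subset by blast
qed

lemma finite_level_le: "finite {v. lev v \<le> n}"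
proof (induction n)
  case 0
  have "{v. lev v \<le> 0} \<subseteq> {r}"
    using level_eq_Suc by force
  thus ?case by (rule finite_subset) simp
next
  case (Suc n)
  have "{v. lev v \<le> Suc n} \<subseteq> insert r (\<Union>u\<in>{v. lev v \<le> n}. chi u)"
    using level_eq_Suc by (auto simp: mem_children_iff)
  thus ?case
    by (rule finite_subset) (use Suc finite_children in auto)
qed

section \<open>The little Lipschitz space\<close>

lemma deriv_diff: "D (\<lambda>v. f v - g v) v = D f v - D g v"
  and deriv_scale: "D (\<lambda>v. c * f v) v = c * D f v"
  by (simp_all add: tree_deriv_def algebra_simps)

lemma deriv_root: "D f r = f r"
  by (simp add: tree_deriv_def)

lemma child_value: "w \<in> chi v \<Longrightarrow> f w = f v + D f w"
  by (auto simp: mem_children_iff tree_deriv_def)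

lemma little_lipschitz_iff:
  "f \<in> X \<longleftrightarrow> (D f \<longlongrightarrow> 0) (filtercomap lev at_top)"
  by (simp add: little_lipschitz_def)

lemma little_lipschitz_iff_level:
  "f \<in> X \<longleftrightarrow> (\<forall>e>0. \<exists>n. \<forall>v. n \<le> lev v \<longrightarrow> cmod (D f v) < e)"
  by (simp add: little_lipschitz_iff tendsto_iff eventually_filtercomap_at_top_linorder)

lemma little_lipschitz_diff: "f \<in> X \<Longrightarrow> g \<in> X \<Longrightarrow> (\<lambda>v. f v - g v) \<in> X"
  unfolding little_lipschitz_iff using tendsto_diff[of "D f" 0 _ "D g" 0]
  by (simp add: deriv_diff[abs_def])

lemma little_lipschitz_scale: "f \<in> X \<Longrightarrow> (\<lambda>v. c * f v) \<in> X"
  unfolding little_lipschitz_iff using tendsto_mult_left[of "D f" 0 _ c]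
  by (simp add: deriv_scale[abs_def])

text \<open>
  The supremum in the norm is over a bounded set: the derivative is small on all but finitely many
  levels, and each level is finite.
\<close>

lemma deriv_le_norm:
  assumes "f \<in> X"
  shows "cmod (D f v) \<le> N f"
proof -
  obtain n where n: "\<And>v. n \<le> lev v \<Longrightarrow> cmod (D f v) < 1"
    using assms zero_less_one unfolding little_lipschitz_iff_level by blast
  have "range (\<lambda>v. cmod (D f v)) \<subseteq> (\<lambda>v. cmod (D f v)) ` {v. lev v \<le> n} \<union> {..1}"
    using n by (auto simp: image_iff) (metis less_imp_le nle_le)
  moreover have "bdd_above ((\<lambda>v. cmod (D f v)) ` {v. lev v \<le> n} \<union> {..1})"
    using finite_level_le by (simp add: bdd_above_finite)
  ultimately have "bdd_above (range (\<lambda>v. cmod (D f v)))"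
    by (rule bdd_above_mono[rotated])
  thus ?thesis
    unfolding lipschitz_norm_def by (intro cSUP_upper) auto
qed

lemma norm_le: "(\<And>v. cmod (D f v) \<le> c) \<Longrightarrow> N f \<le> c"
  unfolding lipschitz_norm_def by (intro cSUP_least) auto

lemma norm_nonneg: "f \<in> X \<Longrightarrow> 0 \<le> N f"
  using deriv_le_norm[of f r] norm_ge_zero order_trans by blast

lemma norm_scale:
  assumes "f \<in> X"
  shows "N (\<lambda>v. c * f v) = cmod c * N f"
proof (rule antisym)
  have le: "N (\<lambda>v. c * f v) \<le> cmod c * N f" if "f \<in> X" for c f
    using deriv_le_norm[OF that]
    by (intro norm_le) (simp add: deriv_scale norm_mult mult_left_mono)
  show "N (\<lambda>v. c * f v) \<le> cmod c * N f"
    using assms by (rule le)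
  show "cmod c * N f \<le> N (\<lambda>v. c * f v)"
  proof (cases "c = 0")
    case True
    thus ?thesis
      using norm_nonneg[OF little_lipschitz_scale[OF assms, of c]] by simp
  next
    case False
    have "N f \<le> cmod (inverse c) * N (\<lambda>v. c * f v)"
      using le[OF little_lipschitz_scale[OF assms, of c], of "inverse c"] False
      by (simp add: mult.assoc[symmetric])
    thus ?thesis
      using False by (simp add: norm_divide inverse_eq_divide field_simps)
  qed
qed

section \<open>Boundedness of the backward shift\<close>

lemma shift_add: "B (\<lambda>v. f v + g v) = (\<lambda>v. B f v + B g v)"
  and shift_diff: "B (\<lambda>v. f v - g v) = (\<lambda>v. B f v - B g v)"
  and shift_scale: "B (\<lambda>v. c * f v) = (\<lambda>v. c * B f v)"
  by (simp_all add: fun_eq_iff backward_shift_def sum.distrib sum_subtractf sum_distrib_left)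

lemma shift_eq: "B f v = of_nat \<gamma> * f v + (\<Sum>w\<in>chi v. D f w)"
proof -
  have "B f v = (\<Sum>w\<in>chi v. f v + D f w)"
    unfolding backward_shift_def by (intro sum.cong refl child_value)
  thus ?thesis by (simp add: sum.distrib)
qed

lemma sum_children_le:
  fixes g :: "'v \<Rightarrow> complex"
  assumes "\<And>w. w \<in> chi v \<Longrightarrow> cmod (g w) \<le> c"
  shows "cmod (\<Sum>w\<in>chi v. g w) \<le> real \<gamma> * c"
  using sum_norm_le[of "chi v" g "\<lambda>_. c"] assms by simp

text \<open>
  By \<open>shift_eq\<close>, \<open>D (B f) v\<close> equals \<open>\<gamma> * D f v\<close> plus the sum of \<open>D f\<close> over the children of \<open>v\<close>, minus
  (below the root) its sum over the siblings of \<open>v\<close> including \<open>v\<close> itself. No vertex above the level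
  of \<open>v\<close> is involved. With \<open>n = 0\<close> this is the boundedness of \<open>B\<close>; with \<open>n\<close> tending to infinity
  it shows that \<open>B\<close> preserves the little Lipschitz space.
\<close>

lemma deriv_shift_le:
  assumes c: "\<And>w. n \<le> lev w \<Longrightarrow> cmod (D f w) \<le> c" and v: "n \<le> lev v"
  shows "cmod (D (B f) v) \<le> 3 * real \<gamma> * c"
proof -
  have v1: "cmod (of_nat \<gamma> * D f v) \<le> real \<gamma> * c"
    using c[OF v] by (simp add: norm_mult mult_left_mono)
  have v2: "cmod (\<Sum>w\<in>chi v. D f w) \<le> real \<gamma> * c"
    using v by (intro sum_children_le c) (simp add: level_children)
  show ?thesis
  proof (cases "v = r")
    case True
    have "D (B f) v = of_nat \<gamma> * D f v + (\<Sum>w\<in>chi v. D f w)"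
      using True by (simp add: deriv_root shift_eq)
    moreover have "0 \<le> real \<gamma> * c"
      using v2 norm_ge_zero order_trans by blast
    ultimately show ?thesis
      using v1 v2 norm_triangle_ineq[of "of_nat \<gamma> * D f v" "\<Sum>w\<in>chi v. D f w"] by simp
  next
    case False
    have v3: "cmod (\<Sum>w\<in>chi (par v). D f w) \<le> real \<gamma> * c"
      using v level_eq_Suc[OF False] by (intro sum_children_le c) (simp add: level_children)
    have "D (B f) v = of_nat \<gamma> * D f v + (\<Sum>w\<in>chi v. D f w) - (\<Sum>w\<in>chi (par v). D f w)"
      using False by (simp add: tree_deriv_def[of E r _ v] shift_eq algebra_simps)
    thus ?thesis
      using v1 v2 v3 norm_triangle_ineq[of "of_nat \<gamma> * D f v" "\<Sum>w\<in>chi v. D f w"]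
        norm_triangle_ineq4[of "of_nat \<gamma> * D f v + (\<Sum>w\<in>chi v. D f w)" "\<Sum>w\<in>chi (par v). D f w"]
      by simp
  qed
qed

lemma shift_mem:
  assumes "f \<in> X"
  shows "B f \<in> X"
  unfolding little_lipschitz_iff_level
proof (intro allI impI)
  fix e :: real assume e: "e > 0"
  (* So 3 * \<gamma> * d is e / 2, and the weak inequality of deriv_shift_le becomes a strict one. *)
  define d where "d = e / (6 * real \<gamma>)"
  have "d > 0" and d: "3 * real \<gamma> * d < e"
    using e order_pos by (simp_all add: d_def)
  then obtain n where "\<And>v. n \<le> lev v \<Longrightarrow> cmod (D f v) < d"
    using assms by (auto simp: little_lipschitz_iff_level)
  hence "cmod (D (B f) v) \<le> 3 * real \<gamma> * d" if "n \<le> lev v" for v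
    using that by (intro deriv_shift_le) (auto intro: less_imp_le)
  thus "\<exists>n. \<forall>v. n \<le> lev v \<longrightarrow> cmod (D (B f) v) < e"
    using d by (meson le_less_trans)
qed

lemma bounded_shifted_shift: "bounded_operator_on X N (shifted_op B z)"
  unfolding bounded_operator_on_def
proof (intro conjI ballI allI exI)
  fix f assume f: "f \<in> X"
  show "shifted_op B z f \<in> X"
    unfolding shifted_op_def using f
    by (intro little_lipschitz_diff little_lipschitz_scale shift_mem)
  show "N (shifted_op B z f) \<le> (3 * real \<gamma> + cmod z) * N f"
  proof (rule norm_le)
    fix v
    have "cmod (D (B f) v) \<le> 3 * real \<gamma> * N f"
      by (rule deriv_shift_le[of 0]) (simp_all add: deriv_le_norm f)
    moreover have "cmod (z * D f v) \<le> cmod z * N f"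
      using deriv_le_norm[OF f] by (simp add: norm_mult mult_left_mono)
    ultimately show "cmod (D (shifted_op B z f) v) \<le> (3 * real \<gamma> + cmod z) * N f"
      using norm_triangle_ineq4[of "D (B f) v" "z * D f v"]
      by (simp add: shifted_op_def deriv_diff deriv_scale algebra_simps)
  qed
next
  fix f g show "shifted_op B z (\<lambda>v. f v + g v) = (\<lambda>v. shifted_op B z f v + shifted_op B z g v)"
    by (simp add: shifted_op_def shift_add algebra_simps)
next
  fix c f show "shifted_op B z (\<lambda>v. c * f v) = (\<lambda>v. c * shifted_op B z f v)"
    by (simp add: shifted_op_def shift_scale algebra_simps)
qed

section \<open>Eigenvectors inside the disc\<close>

lemma shift_power_level:
  "B (\<lambda>v. q ^ lev v) = (\<lambda>v. (of_nat \<gamma> * q) * q ^ lev v)"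
proof
  fix v
  have "B (\<lambda>v. q ^ lev v) v = (\<Sum>w\<in>chi v. q ^ Suc (lev v))"
    unfolding backward_shift_def by (intro sum.cong) (simp_all only: level_children)
  thus "B (\<lambda>v. q ^ lev v) v = (of_nat \<gamma> * q) * q ^ lev v"
    by simp
qed

lemma power_level_mem:
  assumes "cmod q < 1"
  shows "(\<lambda>v. q ^ lev v) \<in> X"
proof -
  define g where "g n = (if n = 0 then 1 else q ^ n - q ^ (n - 1))" for n :: nat
  have "(\<lambda>n. g (Suc n)) \<longlonglongrightarrow> 0"
    using tendsto_diff[OF LIMSEQ_Suc[OF LIMSEQ_power_zero[OF assms]] LIMSEQ_power_zero[OF assms]]
    by (simp add: g_def)
  hence "g \<longlonglongrightarrow> 0"
    by (rule LIMSEQ_imp_Suc)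
  hence "((\<lambda>v. g (lev v)) \<longlongrightarrow> 0) (filtercomap lev at_top)"
    by (rule filterlim_compose) (rule filterlim_filtercomap)
  moreover have "D (\<lambda>v. q ^ lev v) = (\<lambda>v. g (lev v))"
    by (auto simp: fun_eq_iff tree_deriv_def g_def level_eq_Suc)
  ultimately show ?thesis
    by (simp add: little_lipschitz_iff)
qed

text \<open>
  The eigenvector is a multiple of \<open>(z / \<gamma>) ^ |v|\<close>; it is nonzero because its value at the root is.
  For \<open>z = 0\<close> it is the indicator function of the root.
\<close>

lemma unit_eigenvector:
  assumes "cmod z < real \<gamma>"
  obtains f where "f \<in> X" and "N f = 1" and "B f = (\<lambda>v. z * f v)"
proof -
  define q where "q = z / of_nat \<gamma>"
  define e where "e = (\<lambda>v. q ^ lev v)"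
  have z: "z = of_nat \<gamma> * q"
    using order_pos by (simp add: q_def)
  have "cmod q < 1"
    using assms order_pos by (simp add: q_def norm_divide)
  hence e: "e \<in> X"
    unfolding e_def by (rule power_level_mem)
  have "1 \<le> N e"
    using deriv_le_norm[OF e, of r] by (simp add: deriv_root e_def)
  hence "N (\<lambda>v. of_real (1 / N e) * e v) = 1"
    by (subst norm_scale[OF e]) (simp add: norm_divide)
  moreover have "B (\<lambda>v. of_real (1 / N e) * e v) = (\<lambda>v. z * (of_real (1 / N e) * e v))"
    by (subst shift_scale) (simp add: e_def shift_power_level z mult_ac)
  ultimately show thesis
    using that little_lipschitz_scale[OF e] by blast
qed

text \<open>
  Scaling \<open>z\<close> by \<open>n / (n + 1)\<close> moves it into the open disc, which consists of eigenvalues.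
\<close>

lemma disc_subset_approximate_point_spectrum:
  "{z. cmod z \<le> real \<gamma>} \<subseteq> op_approx_point_spectrum X N B"
proof
  fix z assume "z \<in> {z. cmod z \<le> real \<gamma>}"
  hence z: "cmod z \<le> real \<gamma>" by simp
  define t where "t n = of_real (real n / real (Suc n)) * z" for n
  have t: "cmod (t n) < real \<gamma>" for n
  proof -
    have "cmod (t n) = real n / real (Suc n) * cmod z"
      by (simp add: t_def norm_mult norm_divide del: of_nat_Suc)
    also have "\<dots> \<le> real n / real (Suc n) * real \<gamma>"
      using z by (intro mult_left_mono) auto
    also have "\<dots> < 1 * real \<gamma>"
      using order_pos by (intro mult_strict_right_mono) auto
    finally show ?thesis by simp
  qed
  have "\<forall>n. \<exists>f. f \<in> X \<and> N f = 1 \<and> B f = (\<lambda>v. t n * f v)"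
    using unit_eigenvector[OF t] by metis
  then obtain F where F: "\<And>n. F n \<in> X" "\<And>n. N (F n) = 1" "\<And>n. B (F n) = (\<lambda>v. t n * F n v)"
    by metis
  have "shifted_op B z (F n) = (\<lambda>v. (t n - z) * F n v)" for n
    by (simp add: shifted_op_def F(3) algebra_simps)
  hence *: "N (shifted_op B z (F n)) = cmod (t n - z)" for n
    using F by (simp add: norm_scale)
  have "t \<longlonglongrightarrow> of_real 1 * z"
    unfolding t_def by (intro tendsto_intros LIMSEQ_n_over_Suc_n)
  hence "(\<lambda>n. cmod (t n - z)) \<longlonglongrightarrow> 0"
    by (simp add: tendsto_norm_zero LIM_zero)
  thus "z \<in> op_approx_point_spectrum X N B"
    unfolding op_approx_point_spectrum_def using F by (auto simp: * intro!: exI[of _ F])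
qed

section \<open>Powers of the shift and the resolvent outside the disc\<close>

lemma shift_pow_add: "(B ^^ n) (\<lambda>v. f v + g v) = (\<lambda>v. (B ^^ n) f v + (B ^^ n) g v)"
  and shift_pow_diff: "(B ^^ n) (\<lambda>v. f v - g v) = (\<lambda>v. (B ^^ n) f v - (B ^^ n) g v)"
  and shift_pow_scale: "(B ^^ n) (\<lambda>v. c * f v) = (\<lambda>v. c * (B ^^ n) f v)"
  by (induction n) (simp_all add: shift_add shift_diff shift_scale)

lemma shift_pow_mem: "f \<in> X \<Longrightarrow> (B ^^ n) f \<in> X"
  by (induction n) (simp_all add: shift_mem)

text \<open>
  A vertex \<open>n\<close> levels below \<open>v\<close> is reached in \<open>n\<close> steps, each of which changes \<open>f\<close> by at most the
  norm; there are \<open>\<gamma> ^ n\<close> such vertices.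
\<close>

lemma shift_pow_approx:
  assumes f: "f \<in> X"
  shows "cmod ((B ^^ n) f v - of_nat \<gamma> ^ n * f v) \<le> real n * real \<gamma> ^ n * N f"
proof (induction n arbitrary: v)
  case 0
  thus ?case by simp
next
  case (Suc n)
  have "(B ^^ Suc n) f v - of_nat \<gamma> ^ Suc n * f v
      = (\<Sum>w\<in>chi v. (B ^^ n) f w) - (\<Sum>w\<in>chi v. of_nat \<gamma> ^ n * f v)"
    by (simp add: backward_shift_def)
  also have "\<dots> = (\<Sum>w\<in>chi v. ((B ^^ n) f w - of_nat \<gamma> ^ n * f w) + of_nat \<gamma> ^ n * D f w)"
    unfolding sum_subtractf[symmetric]
    by (intro sum.cong refl) (simp add: child_value[of _ v f] algebra_simps)
  also have "cmod \<dots> \<le> real \<gamma> * (real (Suc n) * real \<gamma> ^ n * N f)"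
  proof (rule sum_children_le)
    fix w
    have "cmod (of_nat \<gamma> ^ n * D f w) \<le> real \<gamma> ^ n * N f"
      using deriv_le_norm[OF f] by (simp add: norm_mult norm_power mult_left_mono)
    thus "cmod (((B ^^ n) f w - of_nat \<gamma> ^ n * f w) + of_nat \<gamma> ^ n * D f w)
        \<le> real (Suc n) * real \<gamma> ^ n * N f"
      using Suc.IH[of w] norm_triangle_ineq[of "(B ^^ n) f w - of_nat \<gamma> ^ n * f w" "of_nat \<gamma> ^ n * D f w"]
      by (simp add: algebra_simps)
  qed
  finally show ?case
    by (simp add: algebra_simps)
qed

lemma shift_pow_le:
  assumes f: "f \<in> X"
  shows "cmod ((B ^^ n) f v) \<le> (2 * real n + 1) * real \<gamma> ^ n * (cmod (f v) + N f)"
proof -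
  have "cmod ((B ^^ n) f v)
      \<le> cmod ((B ^^ n) f v - of_nat \<gamma> ^ n * f v) + cmod (of_nat \<gamma> ^ n * f v)"
    using norm_triangle_sub by (metis add.commute)
  also have "\<dots> \<le> real n * real \<gamma> ^ n * N f + real \<gamma> ^ n * cmod (f v)"
    using shift_pow_approx[OF f, of n v] by (simp add: norm_mult norm_power)
  also have "\<dots> \<le> (2 * real n + 1) * real \<gamma> ^ n * N f + (2 * real n + 1) * real \<gamma> ^ n * cmod (f v)"
    using norm_nonneg[OF f] by (intro add_mono mult_right_mono) (auto simp: algebra_simps)
  finally show ?thesis by (simp add: algebra_simps)
qed

text \<open>
  The error in \<open>shift_pow_approx\<close> counts at \<open>v\<close> and at its parent, which gives \<open>2 n\<close>; the
  approximating function \<open>\<gamma> ^ n * f\<close> accounts for the remaining \<open>1\<close>.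
\<close>

lemma deriv_shift_pow_le:
  assumes f: "f \<in> X"
  shows "cmod (D ((B ^^ n) f) v) \<le> (2 * real n + 1) * real \<gamma> ^ n * N f"
proof -
  define h where "h = (\<lambda>v. (B ^^ n) f v - of_nat \<gamma> ^ n * f v)"
  have h: "cmod (h w) \<le> real n * real \<gamma> ^ n * N f" for w
    unfolding h_def by (rule shift_pow_approx[OF f])
  have "cmod (D h v) \<le> 2 * (real n * real \<gamma> ^ n * N f)"
    using h[of v] h[of "par v"] norm_triangle_ineq4[of "h v" "h (par v)"] norm_ge_zero[of "h (par v)"]
    by (auto simp: tree_deriv_def simp del: norm_ge_zero)
  moreover have "cmod (of_nat \<gamma> ^ n * D f v) \<le> real \<gamma> ^ n * N f"
    using deriv_le_norm[OF f] by (simp add: norm_mult norm_power mult_left_mono)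
  moreover have "D ((B ^^ n) f) v = D h v + of_nat \<gamma> ^ n * D f v"
    by (simp add: h_def deriv_diff deriv_scale)
  ultimately show ?thesis
    using norm_triangle_ineq[of "D h v" "of_nat \<gamma> ^ n * D f v"] by (simp add: algebra_simps)
qed

text \<open>
  The Neumann series of the inverse of \<open>B - z\<close>, summed at each vertex separately.
\<close>

definition resolvent :: "complex \<Rightarrow> ('v \<Rightarrow> complex) \<Rightarrow> 'v \<Rightarrow> complex" where
  "resolvent z f v = - (\<Sum>n. (B ^^ n) f v / z ^ Suc n)"

context
  fixes z :: complex
  assumes z: "cmod z > real \<gamma>"
begin

definition majorant :: "nat \<Rightarrow> real" where
  "majorant n = (2 * real n + 1) * real \<gamma> ^ n / cmod z ^ Suc n"

lemma z_nonzero: "z \<noteq> 0"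
  using z by auto

lemma summable_majorant: "summable majorant"
proof -
  have "0 < cmod z"
    using z_nonzero by simp
  hence "\<bar>real \<gamma> / cmod z\<bar> < 1"
    using z by simp
  hence "summable (\<lambda>n. (2 * real n + 1) * (real \<gamma> / cmod z) ^ n / cmod z)"
    by (intro summable_divide summable_linear_times_geometric)
  also have "(\<lambda>n. (2 * real n + 1) * (real \<gamma> / cmod z) ^ n / cmod z) = majorant"
    by (simp add: fun_eq_iff majorant_def power_divide mult.commute)
  finally show ?thesis .
qed

lemma resolvent_term_le:
  "f \<in> X \<Longrightarrow> cmod ((B ^^ n) f v / z ^ Suc n) \<le> majorant n * (cmod (f v) + N f)"
  using divide_right_mono[OF shift_pow_le, of f "cmod z ^ Suc n" n v]
  by (simp add: norm_divide norm_mult norm_power majorant_def)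

text \<open>
  In contrast to \<open>resolvent_term_le\<close>, this bound is uniform in the vertex. It is what makes the
  resolvent bounded and allows limits at infinity to be taken term by term.
\<close>

lemma deriv_resolvent_term_le:
  "f \<in> X \<Longrightarrow> cmod (D ((B ^^ n) f) v / z ^ Suc n) \<le> majorant n * N f"
  using divide_right_mono[OF deriv_shift_pow_le, of f "cmod z ^ Suc n" n v]
  by (simp add: norm_divide norm_mult norm_power majorant_def)

lemma summable_resolvent:
  assumes "f \<in> X"
  shows "summable (\<lambda>n. (B ^^ n) f v / z ^ Suc n)"
  using summable_mult2[OF summable_majorant] resolvent_term_le[OF assms]
  by (rule summable_comparison_test')

lemma resolvent_add:
  "f \<in> X \<Longrightarrow> g \<in> X \<Longrightarrow> resolvent z (\<lambda>v. f v + g v) = (\<lambda>v. resolvent z f v + resolvent z g v)"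
  by (simp add: fun_eq_iff resolvent_def shift_pow_add add_divide_distrib
      suminf_add[OF summable_resolvent summable_resolvent, symmetric] del: power_Suc)

lemma resolvent_diff:
  "f \<in> X \<Longrightarrow> g \<in> X \<Longrightarrow> resolvent z (\<lambda>v. f v - g v) = (\<lambda>v. resolvent z f v - resolvent z g v)"
  by (simp add: fun_eq_iff resolvent_def shift_pow_diff diff_divide_distrib
      suminf_diff[OF summable_resolvent summable_resolvent, symmetric] del: power_Suc)

lemma resolvent_scale:
  "f \<in> X \<Longrightarrow> resolvent z (\<lambda>v. c * f v) = (\<lambda>v. c * resolvent z f v)"
  using suminf_mult[OF summable_resolvent, of f c]
  by (simp add: fun_eq_iff resolvent_def shift_pow_scale)

lemma resolvent_shift:
  assumes "f \<in> X"
  shows "resolvent z (B f) = B (resolvent z f)"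
proof
  fix v
  have "(\<Sum>n. (B ^^ n) (B f) v / z ^ Suc n) = (\<Sum>n. \<Sum>w\<in>chi v. (B ^^ n) f w / z ^ Suc n)"
    unfolding funpow_swap1[symmetric]
    by (simp add: backward_shift_def[of E r "(B ^^ _) f"] sum_divide_distrib)
  also have "\<dots> = (\<Sum>w\<in>chi v. \<Sum>n. (B ^^ n) f w / z ^ Suc n)"
    by (intro suminf_sum summable_resolvent assms)
  finally show "resolvent z (B f) v = B (resolvent z f) v"
    by (simp add: resolvent_def backward_shift_def sum_negf)
qed

lemma deriv_resolvent:
  assumes "f \<in> X"
  shows "D (resolvent z f) v = - (\<Sum>n. D ((B ^^ n) f) v / z ^ Suc n)"
proof (cases "v = r")
  case True
  thus ?thesis by (simp add: deriv_root resolvent_def)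
next
  case False
  thus ?thesis
    by (simp add: tree_deriv_def resolvent_def diff_divide_distrib
      suminf_diff[OF summable_resolvent summable_resolvent, OF assms assms, symmetric] del: power_Suc)
qed

text \<open>
  Each term of the series for the derivative tends to \<open>0\<close> at infinity since the powers of \<open>B\<close>
  preserve the space; dominated convergence over \<open>n\<close> carries this over to the sum.
\<close>

lemma resolvent_mem:
  assumes f: "f \<in> X"
  shows "resolvent z f \<in> X"
proof (cases "filtercomap lev at_top = bot")
  (* Dominated convergence is about nontrivial filters; along the trivial one every limit holds. *)
  case True
  thus ?thesis by (simp add: little_lipschitz_iff)
next
  case False
  have "((\<lambda>v. \<Sum>n. D ((B ^^ n) f) v / z ^ Suc n) \<longlongrightarrow> (\<Sum>n. 0)) (filtercomap lev at_top)"
  proof (rule tannerys_theorem[THEN conjunct2, THEN conjunct2])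
    fix n
    have "((\<lambda>v. D ((B ^^ n) f) v / z ^ Suc n) \<longlongrightarrow> 0 / z ^ Suc n) (filtercomap lev at_top)"
      using shift_pow_mem[OF f, of n] z_nonzero
      by (intro tendsto_intros) (auto simp: little_lipschitz_iff)
    thus "((\<lambda>v. D ((B ^^ n) f) v / z ^ Suc n) \<longlongrightarrow> 0) (filtercomap lev at_top)"
      by simp
  next
    show "summable (\<lambda>n. majorant n * N f)"
      by (intro summable_mult2 summable_majorant)
    show "\<forall>\<^sub>F (n, v) in at_top \<times>\<^sub>F filtercomap lev at_top.
        cmod (D ((B ^^ n) f) v / z ^ Suc n) \<le> majorant n * N f"
      using deriv_resolvent_term_le[OF f] by (intro always_eventually) auto
  qed (rule False)
  from tendsto_minus[OF this] show ?thesis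
    by (simp add: little_lipschitz_iff deriv_resolvent[OF f, abs_def])
qed

lemma bounded_resolvent: "bounded_operator_on X N (resolvent z)"
  unfolding bounded_operator_on_def
proof (intro conjI ballI allI exI)
  fix f assume f: "f \<in> X"
  show "resolvent z f \<in> X"
    using f by (rule resolvent_mem)
  show "N (resolvent z f) \<le> suminf majorant * N f"
  proof (rule norm_le)
    fix v
    have "cmod (\<Sum>n. D ((B ^^ n) f) v / z ^ Suc n) \<le> (\<Sum>n. majorant n * N f)"
      using deriv_resolvent_term_le[OF f]
      by (intro norm_suminf_le summable_mult2 summable_majorant)
    thus "cmod (D (resolvent z f) v) \<le> suminf majorant * N f"
      using suminf_mult2[OF summable_majorant] by (simp add: deriv_resolvent[OF f])
  qed
qed (simp_all add: resolvent_add resolvent_scale)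

lemma resolvent_shifted_op:
  assumes f: "f \<in> X"
  shows "resolvent z (shifted_op B z f) = shifted_op B z (resolvent z f)"
  using f by (simp add: shifted_op_def resolvent_diff resolvent_scale resolvent_shift
      shift_mem little_lipschitz_scale)

text \<open>
  The terms of the series for \<open>(B - z) f\<close> telescope, and \<open>(B ^^ n) f v / z ^ n\<close> tends to \<open>0\<close>.
  The resolvent commutes with \<open>B - z\<close>, so it is a right inverse as well.
\<close>

lemma resolvent_left_inverse:
  assumes f: "f \<in> X"
  shows "resolvent z (shifted_op B z f) = f"
proof
  fix v
  define a where "a n = (B ^^ n) f v / z ^ n" for n
  have "(\<lambda>n. (B ^^ n) f v / z ^ Suc n * z) \<longlonglongrightarrow> 0 * z"
    by (intro tendsto_intros summable_LIMSEQ_zero summable_resolvent f)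
  hence "a \<longlonglongrightarrow> 0"
    using z_nonzero by (simp add: a_def[abs_def])
  hence "(\<lambda>n. a (Suc n) - a n) sums (0 - a 0)"
    by (rule telescope_sums)
  moreover have "(B ^^ n) (shifted_op B z f) v / z ^ Suc n = a (Suc n) - a n" for n
    using z_nonzero
    by (simp add: shifted_op_def shift_pow_diff shift_pow_scale a_def funpow_swap1 field_simps)
  ultimately show "resolvent z (shifted_op B z f) v = f v"
    by (simp add: resolvent_def sums_iff a_def del: power_Suc)
qed

lemma not_in_spectrum: "z \<notin> op_spectrum X N B"
proof -
  have "boundedly_invertible_on X N (shifted_op B z)"
    unfolding boundedly_invertible_on_def
    using bounded_shifted_shift bounded_resolvent resolvent_left_inverse resolvent_shifted_op
    by metis
  thus ?thesis by (simp add: op_spectrum_def)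
qed

end

lemma spectrum_subset_disc: "op_spectrum X N B \<subseteq> {z. cmod z \<le> real \<gamma>}"
  using not_in_spectrum by force

end

section \<open>The spectrum of the backward shift\<close>

theorem theorem6p3:
  fixes E :: "'v \<Rightarrow> 'v \<Rightarrow> bool" and r :: 'v and \<gamma> :: nat
  assumes "is_tree E"
    and "infinite (UNIV :: 'v set)" and "countable (UNIV :: 'v set)"
    and "locally_finite_graph E"
    and "homogeneous_tree E r \<gamma>"
  shows "op_spectrum (little_lipschitz E r) (lipschitz_norm E r) (backward_shift E r)
           = {z. cmod z \<le> real \<gamma>}
       \<and> op_approx_point_spectrum (little_lipschitz E r) (lipschitz_norm E r) (backward_shift E r)
           = {z. cmod z \<le> real \<gamma>}"
proof -
  interpret rooted_homogeneous_tree E r \<gamma>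
    using assms by unfold_locales
  show ?thesis
    using disc_subset_approximate_point_spectrum spectrum_subset_disc
      approximate_point_spectrum_subset_spectrum[of X N B]
    by blast
qed

end
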